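(* Let $n$ be a positive integer, and let $\mathbf{Y} = (Y_1, Y_2, \dots, Y_n)'$ be the random vector whose $j$th component $Y_j$ is the number of $j$-cycles of a uniformly random permutation in the symmetric group $\mathfrak{S}_n$. Then $$E(\mathbf{Y}) = \left(1, \tfrac12, \tfrac13, \dots, \tfrac1n\right)'.$$
   Context: The prime $'$ denotes transpose (vectors are column vectors). A permutation is chosen from $\mathfrak{S}_n$ with each permutation having probability $1/n!$; fixed points count as $1$-cycles, so $Y_j$ is the multiplicity of the part $j$ in the partition of $n$ given by the cycle type of the permutation. Equivalently, $\mathbf{Y}$ is supported on the vectors $(y_1,\dots,y_n)'$ of nonnegative integers with $y_1+2y_2+\cdots+ny_n=n$, and $$P\big(\mathbf{Y}=(y_1,\dots,y_n)'\big) = \frac{1}{1^{y_1}2^{y_2}\cdots n^{y_n}\, y_1!\,y_2!\cdots y_n!}.$$ *)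

theory Defs
  imports
    "HOL-Probability.Probability_Mass_Function"
    "HOL-Combinatorics.Orbits"
    "Jordan_Normal_Form.Matrix"
begin

definition uniform_perm :: "nat \<Rightarrow> (nat \<Rightarrow> nat) pmf" where
  "uniform_perm n = pmf_of_set {p. p permutes {1..n}}"

text \<open>A cycle is identified with the set of points it moves around, that is, with an orbit;
  a fixed point gives the 1-cycle consisting of that point alone.\<close>

definition cycles :: "nat \<Rightarrow> (nat \<Rightarrow> nat) \<Rightarrow> nat set set" where
  "cycles n p = orbit p ` {1..n}"

definition num_cycles :: "nat \<Rightarrow> (nat \<Rightarrow> nat) \<Rightarrow> nat \<Rightarrow> nat" where
  "num_cycles n p j = card {C \<in> cycles n p. card C = j}"

text \<open>Vectors of type \<^typ>\<open>'a Matrix.vec\<close> are indexed from 0, so the entry with index \<open>i\<close>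
  is the component number \<open>i + 1\<close> of the vector \<open>(Y\<^sub>1, \<dots>, Y\<^sub>n)'\<close>.\<close>

definition cycle_count_vec :: "nat \<Rightarrow> (nat \<Rightarrow> nat) \<Rightarrow> real Matrix.vec" where
  "cycle_count_vec n p = Matrix.vec n (\<lambda>i. real (num_cycles n p (i + 1)))"

text \<open>The type of vectors of dimension \<open>n\<close> is not a Banach space, since \<open>n\<close> is a term; the
  expectation of a random vector is therefore taken componentwise.\<close>

definition expectation_vec :: "nat \<Rightarrow> 'a pmf \<Rightarrow> ('a \<Rightarrow> real Matrix.vec) \<Rightarrow> real Matrix.vec" where
  "expectation_vec n M Y = Matrix.vec n (\<lambda>i. measure_pmf.expectation M (\<lambda>\<omega>. vec_index (Y \<omega>) i))"

end

theory Submission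
  imports Defs
begin

text \<open>By double counting, \<open>j\<close> times the number of \<open>j\<close>-cycles of \<open>p\<close> is the number of points whose
  cycle has length \<open>j\<close> (lemma \<open>mult_num_cycles\<close>). So everything reduces to the classical fact that
  the length of the cycle through a given point \<open>x\<close> of an \<open>n\<close>-set is uniformly distributed on
  \<open>{1..n}\<close>: for each such length \<open>j\<close> there are exactly \<open>(n - 1)!\<close> permutations (lemma
  \<open>card_permutes_orbit_length\<close>). Summing over the \<open>n\<close> points gives \<open>n!\<close> pairs of a permutation and
  a point on one of its \<open>j\<close>-cycles, hence \<open>j * E(Y\<^sub>j) = n! / n! = 1\<close>.

  The uniformity is proved by induction on \<open>j\<close>. If \<open>p x = y\<close> with \<open>y \<noteq> x\<close>, then removing \<open>y\<close> from its
  cycle, that is, sending \<open>x\<close> directly to \<open>p y\<close>, gives a permutation of the remaining points in which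
  the cycle through \<open>x\<close> is shorter by one, and \<open>y\<close> together with this permutation determines \<open>p\<close>.
  This yields \<open>(n - 1) * (n - 2)! = (n - 1)!\<close> permutations, as claimed.\<close>

text \<open>Composing with the transposition on the right inserts \<open>y\<close> right after \<open>x\<close> into the cycle of
  \<open>x\<close>; for \<open>x = y\<close> this describes the permutations that fix \<open>x\<close>.\<close>

lemma permutes_mapsto_eq_image:
  assumes "x \<in> S" "y \<in> S"
  shows "{p. p permutes S \<and> p x = y} = (\<lambda>q. q \<circ> Transposition.transpose x y) ` {q. q permutes S - {y}}"
proof (intro equalityI subsetI)
  fix p assume "p \<in> {p. p permutes S \<and> p x = y}"
  then have p: "p permutes S" "p x = y" by auto
  let ?q = "p \<circ> Transposition.transpose x y"
  have "?q permutes S"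
    using p(1) assms by (intro permutes_compose permutes_swap_id)
  then have "?q permutes S - {y}"
    by (rule permutes_superset) (use p(2) in auto)
  moreover have "p = ?q \<circ> Transposition.transpose x y"
    by (simp add: fun_eq_iff)
  ultimately show "p \<in> (\<lambda>q. q \<circ> Transposition.transpose x y) ` {q. q permutes S - {y}}"
    by blast
next
  fix p assume "p \<in> (\<lambda>q. q \<circ> Transposition.transpose x y) ` {q. q permutes S - {y}}"
  then obtain q where q: "q permutes S - {y}" and p: "p = q \<circ> Transposition.transpose x y" by auto
  have "q permutes S"
    using q by (rule permutes_subset) auto
  then have "p permutes S"
    unfolding p using assms by (intro permutes_compose permutes_swap_id)
  moreover have "p x = y"
    using permutes_not_in[OF q] by (simp add: p)
  ultimately show "p \<in> {p. p permutes S \<and> p x = y}" by blast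
qed

lemma inj_comp_transpose: "inj (\<lambda>q. q \<circ> Transposition.transpose x y)"
  by (rule inj_on_inverseI[where g = "\<lambda>q. q \<circ> Transposition.transpose x y"]) (simp add: fun_eq_iff)

lemma orbit_comp_transpose:
  assumes "q y = y" "x \<noteq> y"
  shows "orbit (q \<circ> Transposition.transpose x y) x = insert y (orbit q x)" (is "orbit ?p x = _")
proof
  have px: "?p x = y" and py: "?p y = q x"
    using assms by auto
  have pz: "?p z = q z" if "z \<noteq> x" "z \<noteq> y" for z
    using that by (simp add: transpose_apply_other)
  show "orbit ?p x \<subseteq> insert y (orbit q x)"
  proof
    fix z assume "z \<in> orbit ?p x"
    then show "z \<in> insert y (orbit q x)"
    proof induction
      case base
      show ?case by (simp only: px insertI1)
    next
      case (step z)
      then show ?case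
        by (metis insert_iff orbit.base orbit.step px py pz)
    qed
  qed
  have y: "y \<in> orbit ?p x"
    using orbit.base[of ?p x] px by simp
  have qx: "q x \<in> orbit ?p x"
    using orbit.step[OF y] py by simp
  have "z \<in> orbit ?p x" if "z \<in> orbit q x" for z
    using that
  proof induction
    case base
    show ?case by (rule qx)
  next
    case (step z)
    show ?case
    proof (cases "z = x \<or> z = y")
      case True
      then show ?thesis using qx y assms(1) by metis
    next
      case False
      then show ?thesis using orbit.step[OF step.IH] pz by metis
    qed
  qed
  with y show "insert y (orbit q x) \<subseteq> orbit ?p x" by blast
qed

lemma card_orbit_comp_transpose:
  assumes "finite S" "q permutes S - {y}" "x \<in> S - {y}"
  shows "card (orbit (q \<circ> Transposition.transpose x y) x) = Suc (card (orbit q x))"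
proof -
  have "orbit q x \<subseteq> S - {y}"
    using assms(2,3) by (rule permutes_orbit_subset)
  then have "y \<notin> orbit q x" "finite (orbit q x)"
    using assms(1) by (auto intro: finite_subset)
  moreover have "q y = y"
    using permutes_not_in[OF assms(2)] by simp
  ultimately show ?thesis
    using assms(3) by (simp add: orbit_comp_transpose)
qed

text \<open>In the induction step the permutations are sorted by the image \<open>y\<close> of \<open>x\<close>, and \<open>y\<close> is then
  removed from its cycle. This leaves a set of size \<open>card S - 1\<close>, which is why the induction on the
  cycle length needs \<open>S\<close> to vary and why the count does not depend on \<open>j\<close>.\<close>

lemma card_permutes_orbit_length:
  assumes "finite S" "x \<in> S" "Suc j \<le> card S"
  shows "card {p. p permutes S \<and> card (orbit p x) = Suc j} = fact (card S - 1)"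
  using assms
proof (induction j arbitrary: S)
  case 0
  have "card (orbit p x) = 1 \<longleftrightarrow> p x = x" if "p permutes S" for p
    using eq_on_cyclic_on_iff1[OF cyclic_on_orbit[OF that \<open>finite S\<close>, of x]]
      permutation_self_in_orbit that \<open>finite S\<close> by (metis permutation_permutes)
  then have "{p. p permutes S \<and> card (orbit p x) = Suc 0} = {p. p permutes S \<and> p x = x}"
    by auto
  also have "\<dots> = {p. p permutes S - {x}}"
    using permutes_mapsto_eq_image[OF 0(2) 0(2)] by (simp add: image_def)
  finally show ?case
    using 0 by (simp add: card_permutations[OF refl])
next
  case (Suc j)
  let ?A = "\<lambda>y. {p. p permutes S \<and> p x = y \<and> card (orbit p x) = Suc (Suc j)}"
  have card_A: "card (?A y) = fact (card S - 2)" if y: "y \<in> S - {x}" for y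
  proof -
    let ?f = "\<lambda>q. q \<circ> Transposition.transpose x y"
    let ?B = "{q. q permutes S - {y} \<and> card (orbit q x) = Suc j}"
    have "?A y = {p \<in> {p. p permutes S \<and> p x = y}. card (orbit p x) = Suc (Suc j)}"
      by auto
    also have "\<dots> = ?f ` {q. q permutes S - {y} \<and> card (orbit (?f q) x) = Suc (Suc j)}"
      using Suc.prems(2) y by (subst permutes_mapsto_eq_image) auto
    also have "{q. q permutes S - {y} \<and> card (orbit (?f q) x) = Suc (Suc j)} = ?B"
      using Suc.prems y card_orbit_comp_transpose[of S _ y x] by auto
    finally have "card (?A y) = card ?B"
      by (simp only: card_image[OF inj_on_subset[OF inj_comp_transpose subset_UNIV]])
    also have "\<dots> = fact (card (S - {y}) - 1)"
      using Suc.prems y by (intro Suc.IH) auto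
    finally show ?thesis
      using Suc.prems y by (simp add: numeral_2_eq_2)
  qed
  \<comment> \<open>A fixed point \<open>x\<close> would have a cycle of length \<open>1\<close>, so \<open>p x\<close> ranges over \<open>S - {x}\<close> only.\<close>
  have "{p. p permutes S \<and> card (orbit p x) = Suc (Suc j)} = (\<Union>y\<in>S - {x}. ?A y)"
  proof -
    have "p x \<in> S - {x}" if "p permutes S" "card (orbit p x) = Suc (Suc j)" for p
    proof -
      have "p x \<noteq> x"
        using that(2) by (auto simp flip: orbit_eq_singleton_iff)
      then show ?thesis
        using that(1) Suc.prems(2) by (simp add: permutes_in_image)
    qed
    then show ?thesis by auto
  qed
  also have "card \<dots> = (\<Sum>y\<in>S - {x}. card (?A y))"
    using Suc.prems(1)
    by (intro card_UN_disjoint) (auto intro: finite_subset[OF _ finite_permutations[of S]])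
  also have "\<dots> = (card S - 1) * fact (card S - 2)"
    using Suc.prems by (simp add: card_A)
  also have "\<dots> = fact (card S - 1)"
    using Suc.prems(3) by (subst (2) fact_reduce) (auto simp: numeral_2_eq_2)
  finally show ?case .
qed

text \<open>The \<open>j\<close>-cycles partition the set of points whose cycle has length \<open>j\<close>.\<close>

lemma mult_num_cycles:
  assumes "p permutes {1..n}"
  shows "j * num_cycles n p j = card {x \<in> {1..n}. card (orbit p x) = j}"
proof -
  let ?C = "{C \<in> cycles n p. card C = j}"
  have perm: "permutation p"
    using assms by (auto simp: permutation_permutes)
  have orbit_eq: "orbit p y = orbit p x" if "y \<in> orbit p x" for x y
    using cyclic_on_orbit'[OF perm] that by (rule orbit_cyclic_eq3)
  have self: "x \<in> orbit p x" for x
    by (rule permutation_self_in_orbit[OF perm])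
  have union: "\<Union>?C = {x \<in> {1..n}. card (orbit p x) = j}"
  proof (intro equalityI subsetI)
    fix y assume "y \<in> \<Union>?C"
    then obtain x where x: "x \<in> {1..n}" "y \<in> orbit p x" "card (orbit p x) = j"
      by (auto simp: cycles_def)
    moreover have "y \<in> {1..n}"
      using permutes_orbit_subset[OF assms x(1)] x(2) by blast
    ultimately show "y \<in> {x \<in> {1..n}. card (orbit p x) = j}"
      using orbit_eq[OF x(2)] by simp
  next
    fix x assume "x \<in> {x \<in> {1..n}. card (orbit p x) = j}"
    then show "x \<in> \<Union>?C"
      using self[of x] unfolding cycles_def by blast
  qed
  have "j * card ?C = card (\<Union>?C)"
  proof (rule card_partition)
    show "finite ?C" by (simp add: cycles_def)
    show "finite (\<Union>?C)" unfolding union by simp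
    show "c1 \<inter> c2 = {}" if C: "c1 \<in> ?C" "c2 \<in> ?C" "c1 \<noteq> c2" for c1 c2
    proof -
      obtain x1 x2 where x: "c1 = orbit p x1" "c2 = orbit p x2"
        using C(1,2) by (auto simp: cycles_def)
      show ?thesis
        using C(3) orbit_eq[of _ x1] orbit_eq[of _ x2] unfolding x by blast
    qed
  qed simp
  then show ?thesis
    unfolding union num_cycles_def .
qed

lemma sum_num_cycles:
  assumes "1 \<le> j" "j \<le> n"
  shows "j * (\<Sum>p | p permutes {1..n}. num_cycles n p j) = fact n"
proof -
  have "j * (\<Sum>p | p permutes {1..n}. num_cycles n p j) =
      (\<Sum>p | p permutes {1..n}. card {x \<in> {1..n}. card (orbit p x) = j})"
    by (simp add: sum_distrib_left mult_num_cycles)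
  also have "\<dots> = fact (n - 1) * card {1..n}"
    using card_permutes_orbit_length[of "{1..n}" _ "j - 1"] assms
    by (intro sum_multicount) (auto simp: finite_permutations)
  also have "\<dots> = fact n"
    using assms by (simp add: fact_reduce[of n] mult.commute)
  finally show ?thesis .
qed

theorem corollary3p6:
  fixes n :: nat
  assumes "n > 0"
  shows "expectation_vec n (uniform_perm n) (cycle_count_vec n) =
         Matrix.vec n (\<lambda>i. 1 / real (i + 1))"
proof -
  let ?P = "{p. p permutes {1..n}}"
  have fin: "finite ?P" by (simp add: finite_permutations)
  have ne: "?P \<noteq> {}" using permutes_id by blast
  have card: "card ?P = fact n" by (simp add: card_permutations[OF refl])
  have "measure_pmf.expectation (uniform_perm n) (\<lambda>p. vec_index (cycle_count_vec n p) i) =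
      1 / real (i + 1)" if "i < n" for i
  proof -
    have "real (i + 1) * (\<Sum>p\<in>?P. real (num_cycles n p (i + 1))) = fact n"
      using sum_num_cycles[of "i + 1" n, THEN arg_cong[where f = real]] that
      by (simp only: of_nat_mult of_nat_sum of_nat_fact)
    then have "(\<Sum>p\<in>?P. real (num_cycles n p (i + 1))) / fact n = 1 / real (i + 1)"
      by (simp add: field_simps)
    then show ?thesis
      using that unfolding uniform_perm_def integral_pmf_of_set[OF ne fin] card
      by (simp add: cycle_count_vec_def)
  qed
  then show ?thesis
    by (auto simp: expectation_vec_def)
qed

end
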